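(* Let $(k,\theta)\gg 0$ with $k\in K$, $\theta\in\Theta^n$. Let $s:\hat X\times\Theta^n\to X\subset\mathbb{R}_+^n$ be an optimal consumption profile for the Pareto problem (PP), as a function of aggregate consumption $\hat x$ and the Pareto weights $\theta$, where $0<\hat x\le f(k)-y$ for some $y\in\Gamma(k)\setminus\{0\}$ and $\hat x=\sum_{i} s^i(\hat x,\theta)$; that is, $s(\hat x,\theta)$ solves $\sup_{x}\{\sum_i\theta^i u_i(x^i):\sum_i x^i\le\hat x\}$. Let $F:\Theta^n\to\Theta^n$ be the transition map for the Pareto weights associated with the optimal choice of $\tau$ in (PP), namely $$F^i(\theta)=\frac{\theta^i\delta^i}{\sum_{j=1}^n\theta^j\delta^j},\qquad i=1,\dots,n.$$ Then there exist an aggregate periodic utility function $U:\hat X\times\Theta^n\to\mathbb{R}\cup\{-\infty\}$, defined as $$U(\hat x,\theta):=\sum_{i=1}^n\theta^i u_i\big(s^i(\hat x,\theta)\big),$$ and an aggregate discount rate $\mu:\Theta^n\to\mathbb{R}_+$, given by $$\mu(\theta):=\sum_{i=1}^n\theta^i\delta^i,$$ such that the value $V$ of (PP) satisfies the functional equation $$V(k,\theta)=\sup_{y\in\Gamma(k)}\Big[U(f(k)-y,\theta)+\mu(\theta)\,V(y,F(\theta))\Big]$$ for all $(k,\theta)$ in the interior of $K\times\Theta^n$ (i.e. $0<k<k_m$ and $\theta^i>0$ for all $i$).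
   Context: Agents are $N=\{1,\dots,n\}$, $n\ge 2$; time is $t=0,1,2,\dots$. Discount factors satisfy $1>\delta^1>\delta^2\ge\cdots\ge\delta^n>0$. Preferences: for each $i$, $u_i:\mathbb{R}_+\to\mathbb{R}\cup\{-\infty\}$ is continuous, strictly increasing, strictly concave, with $u_i(0)=0$ or $u_i(0)=-\infty$; it is twice continuously differentiable on $(0,\infty)$, and if $u_i(0)=0$ then $\lim_{x\to0^+}u_i'(x)=+\infty$. A bounded nonnegative consumption sequence $\mathbf{x}^i=(x^i_0,x^i_1,\dots)$ gives agent $i$ utility $w^i(\mathbf{x}^i)=\sum_{t\ge0}(\delta^i)^t u_i(x^i_t)$. Conventions: $0\cdot(\pm\infty)=0$, $a\cdot(\pm\infty)=\pm\infty$ for $a>0$. Technology: $f:\mathbb{R}_+\to\mathbb{R}_+$ is continuous, strictly increasing, strictly concave, $f(0)=0$, differentiable on $(0,\infty)$, $\lim_{k\to0^+}f'(k)>1/\delta^n$, $\lim_{k\to\infty}f'(k)=0$. Let $k_m>0$ be the maximum sustainable capital level ($f(k_m)=k_m$) and $K=[0,k_m]$. Put $\Gamma(k)=\{y\in K:0\le y\le f(k)\}$. $\Pi(k_0)$ is the set of capital sequences $(k_0,k_1,\dots)$ with $k_{t+1}\in\Gamma(k_t)$ for all $t$. $\Omega(k_0)$ is the set of bounded sequences $\mathbf{x}=(x_0,x_1,\dots)$ with $x_t=(x_t^1,\dots,x_t^n)\in\mathbb{R}_+^n$ and $0\le\sum_i x^i_t\le f(k_t)-k_{t+1}$ for all $t$,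 for some $\mathbf{k}\in\Pi(k_0)$. $\hat X\subset\mathbb{R}_+$ is the set of feasible aggregate consumption levels (those $\hat x$ with $0\le\hat x\le f(k)-y$ for some $k\in K$, $y\in\Gamma(k)$), and $X\subset\mathbb{R}^n_+$ is the space of consumption profiles $x=(x^1,\dots,x^n)$. (For $\hat x=0$, $s(0,\theta)=0$.) Weights: $\Theta^n=\{\theta\in\mathbb{R}_+^n:\sum_i\theta^i=1\}$. Utility possibility set: $\mathcal{U}(k)=\{z\in(\mathbb{R}\cup\{-\infty\})^n: z^i=w^i(\mathbf{x}^i)\ \forall i,\text{ for some }\mathbf{x}\in\Omega(k)\}$. Value function of the Pareto problem: $V(k,\theta)=\sup_{z\in\mathcal{U}(k)}\sum_{i}\theta^i z^i$. Problem (PP): given $(k,\theta)$, choose $x\in X$, $y\ge0$, continuation utilities $z\in\mathcal{U}(y)$ (sup) and next-period weights $\tau\in\Theta^n$ (inf) in $\sup_{x,y,z}\inf_{\tau}\sum_i\theta^i[u_i(x^i)+\delta^i z^i]$ subject to $\sum_i x^i+y\le f(k)$ and $\sum_i\tau^i z^i-V(y,\tau)\le 0$. The last constraint is to hold for all $\tau$, the optimal $\tau$ being the one minimizing $V(y,\tau)-\sum_i\tau^iz^i$. The value of (PP) at $(k,\theta)$ is $V(k,\theta)$. *)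

theory Defs
  imports "HOL-Analysis.Analysis"
begin

text \<open>
  Agents are the elements of a finite linearly ordered type \<open>'n\<close>, listed in increasing order:
  \<open>Min UNIV\<close> is agent \<open>1\<close> (the most patient one), \<open>Max UNIV\<close> is agent \<open>n\<close>.
  Utilities take values in \<open>ereal\<close>, never \<open>\<infinity>\<close> on the nonnegative reals. In \<open>ereal\<close> we have
  \<open>0 * (-\<infinity>) = 0\<close> and \<open>a * (-\<infinity>) = -\<infinity>\<close> for \<open>a > 0\<close>.
\<close>

definition strictly_concave_on :: "real set \<Rightarrow> (real \<Rightarrow> ereal) \<Rightarrow> bool" where
  "strictly_concave_on S g \<longleftrightarrow> convex S \<and>
     (\<forall>x\<in>S. \<forall>y\<in>S. \<forall>t. x \<noteq> y \<and> 0 < t \<and> t < 1 \<longrightarrow>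
        ereal (1 - t) * g x + ereal t * g y < g ((1 - t) * x + t * y))"

definition admissible_utility :: "(real \<Rightarrow> ereal) \<Rightarrow> bool" where
  "admissible_utility u \<longleftrightarrow>
     (\<forall>x\<ge>0. u x \<noteq> \<infinity>) \<and>
     continuous_on {0..} u \<and> strict_mono_on {0..} u \<and> strictly_concave_on {0..} u \<and>
     (u 0 = 0 \<or> u 0 = -\<infinity>) \<and>
     (let v = (\<lambda>x. real_of_ereal (u x)) in
        v differentiable_on {0<..} \<and> deriv v differentiable_on {0<..} \<and>
        continuous_on {0<..} (deriv (deriv v)) \<and>
        (u 0 = 0 \<longrightarrow> filterlim (deriv v) at_top (at_right 0)))"

text \<open>The limit of the marginal product at \<open>0\<close> is taken in \<open>ereal\<close>, so that it may be infinite.\<close>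

definition admissible_technology :: "real \<Rightarrow> (real \<Rightarrow> real) \<Rightarrow> bool" where
  "admissible_technology d f \<longleftrightarrow>
     (\<forall>k\<ge>0. 0 \<le> f k) \<and> f 0 = 0 \<and>
     continuous_on {0..} f \<and> strict_mono_on {0..} f \<and>
     strictly_concave_on {0..} (\<lambda>k. ereal (f k)) \<and>
     f differentiable_on {0<..} \<and>
     (\<exists>L. ((\<lambda>k. ereal (deriv f k)) \<longlongrightarrow> L) (at_right 0) \<and> ereal (1 / d) < L) \<and>
     (deriv f \<longlongrightarrow> 0) at_top"

text \<open>The positive fixed point \<open>km\<close> of the strictly concave \<open>f\<close> (with \<open>f 0 = 0\<close>) is unique.\<close>

locale economy =
  fixes \<delta> :: "'n::{finite,linorder} \<Rightarrow> real"
    and u :: "'n \<Rightarrow> real \<Rightarrow> ereal"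
    and f :: "real \<Rightarrow> real"
    and km :: real
  assumes two_agents: "2 \<le> CARD('n)"
    and discount_lt_1: "\<delta> (Min UNIV) < 1"
    and discount_first: "\<And>j. j \<noteq> Min UNIV \<Longrightarrow> \<delta> j < \<delta> (Min UNIV)"
    and discount_antimono: "\<And>i j. i \<le> j \<Longrightarrow> \<delta> j \<le> \<delta> i"
    and discount_pos: "0 < \<delta> (Max UNIV)"
    and utility: "\<And>i. admissible_utility (u i)"
    and technology: "admissible_technology (\<delta> (Max UNIV)) f"
    and km_pos: "0 < km"
    and km_fixed: "f km = km"

definition nonneg_profiles :: "(real ^ 'n) set" where
  "nonneg_profiles = {x. \<forall>i. 0 \<le> x $ i}"

definition weights :: "(real ^ 'n) set" where
  "weights = {\<theta> \<in> nonneg_profiles. (\<Sum>i\<in>UNIV. \<theta> $ i) = 1}"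

definition feasible_capital :: "(real \<Rightarrow> real) \<Rightarrow> real \<Rightarrow> real \<Rightarrow> real set" where
  "feasible_capital f km k = {y \<in> {0..km}. y \<le> f k}"

definition capital_paths :: "(real \<Rightarrow> real) \<Rightarrow> real \<Rightarrow> real \<Rightarrow> (nat \<Rightarrow> real) set" where
  "capital_paths f km k0 = {k. k 0 = k0 \<and> (\<forall>t. k (Suc t) \<in> feasible_capital f km (k t))}"

definition allocations :: "(real \<Rightarrow> real) \<Rightarrow> real \<Rightarrow> real \<Rightarrow> (nat \<Rightarrow> real ^ 'n) set" where
  "allocations f km k0 = {x. bounded (range x) \<and> (\<forall>t. x t \<in> nonneg_profiles) \<and>
     (\<exists>k\<in>capital_paths f km k0. \<forall>t.
        0 \<le> (\<Sum>i\<in>UNIV. x t $ i) \<and> (\<Sum>i\<in>UNIV. x t $ i) \<le> f (k t) - k (Suc t))}"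

definition aggregate_levels :: "(real \<Rightarrow> real) \<Rightarrow> real \<Rightarrow> real set" where
  "aggregate_levels f km =
     {xh. \<exists>k\<in>{0..km}. \<exists>y\<in>feasible_capital f km k. 0 \<le> xh \<and> xh \<le> f k - y}"

text \<open>
  For bounded nonnegative consumption and an admissible utility the partial sums are finite or
  \<open>-\<infinity>\<close> and their positive parts are summable, so this series converges in \<open>ereal\<close>,
  to a value different from \<open>\<infinity>\<close>.
\<close>

definition lifetime_utility :: "real \<Rightarrow> (real \<Rightarrow> ereal) \<Rightarrow> (nat \<Rightarrow> real) \<Rightarrow> ereal" where
  "lifetime_utility d u x = (\<Sum>t. ereal (d ^ t) * u (x t))"

definition utility_possibilities ::
    "('n \<Rightarrow> real) \<Rightarrow> ('n \<Rightarrow> real \<Rightarrow> ereal) \<Rightarrow> (real \<Rightarrow> real) \<Rightarrow> real \<Rightarrow> real \<Rightarrow> (ereal ^ 'n) set" where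
  "utility_possibilities \<delta> u f km k =
     {z. \<exists>x\<in>allocations f km k. \<forall>i. z $ i = lifetime_utility (\<delta> i) (u i) (\<lambda>t. x t $ i)}"

definition pareto_value ::
    "('n \<Rightarrow> real) \<Rightarrow> ('n \<Rightarrow> real \<Rightarrow> ereal) \<Rightarrow> (real \<Rightarrow> real) \<Rightarrow> real \<Rightarrow> real \<Rightarrow> real ^ 'n \<Rightarrow> ereal" where
  "pareto_value \<delta> u f km k \<theta> =
     (SUP z\<in>utility_possibilities \<delta> u f km k. \<Sum>i\<in>UNIV. ereal (\<theta> $ i) * z $ i)"

text \<open>
  The value of problem (PP). The constraint on \<open>(y, z)\<close> has to hold for all weights \<open>\<tau>\<close>; it is
  written without subtraction because \<open>-\<infinity> - (-\<infinity>) = \<infinity>\<close> in \<open>ereal\<close>.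
\<close>

definition pp_feasible ::
    "('n \<Rightarrow> real) \<Rightarrow> ('n \<Rightarrow> real \<Rightarrow> ereal) \<Rightarrow> (real \<Rightarrow> real) \<Rightarrow> real \<Rightarrow> real \<Rightarrow>
      ((real ^ 'n) \<times> real \<times> (ereal ^ 'n)) set" where
  "pp_feasible \<delta> u f km k =
     {(x, y, z). x \<in> nonneg_profiles \<and> 0 \<le> y \<and> z \<in> utility_possibilities \<delta> u f km y \<and>
        (\<Sum>i\<in>UNIV. x $ i) + y \<le> f k \<and>
        (\<forall>\<tau>\<in>weights. (\<Sum>i\<in>UNIV. ereal (\<tau> $ i) * z $ i) \<le> pareto_value \<delta> u f km y \<tau>)}"

definition pp_value ::
    "('n \<Rightarrow> real) \<Rightarrow> ('n \<Rightarrow> real \<Rightarrow> ereal) \<Rightarrow> (real \<Rightarrow> real) \<Rightarrow> real \<Rightarrow> real \<Rightarrow> real ^ 'n \<Rightarrow> ereal" where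
  "pp_value \<delta> u f km k \<theta> =
     (SUP (x, y, z)\<in>pp_feasible \<delta> u f km k. INF \<tau>\<in>(weights :: (real ^ 'n) set).
        \<Sum>i\<in>UNIV. ereal (\<theta> $ i) * (u i (x $ i) + ereal (\<delta> i) * z $ i))"

definition weighted_utility ::
    "('n \<Rightarrow> real \<Rightarrow> ereal) \<Rightarrow> real ^ 'n \<Rightarrow> real ^ 'n \<Rightarrow> ereal" where
  "weighted_utility u \<theta> x = (\<Sum>i\<in>UNIV. ereal (\<theta> $ i) * u i (x $ i))"

text \<open>
  Optimality is required at strictly positive weights and at the levels \<open>0 < xh \<le> f k - y\<close> with
  \<open>y \<noteq> 0\<close> for some \<open>k\<close>, i.e. for \<open>0 < xh < km\<close>. The level \<open>xh = f k\<close> with \<open>k < km\<close> is among them.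
\<close>

definition optimal_profile ::
    "('n \<Rightarrow> real \<Rightarrow> ereal) \<Rightarrow> (real \<Rightarrow> real) \<Rightarrow> real \<Rightarrow> (real \<Rightarrow> real ^ 'n \<Rightarrow> real ^ 'n) \<Rightarrow> bool" where
  "optimal_profile u f km s \<longleftrightarrow>
     (\<forall>xh\<in>aggregate_levels f km. \<forall>\<theta>\<in>weights. s xh \<theta> \<in> nonneg_profiles) \<and>
     (\<forall>\<theta>\<in>weights. s 0 \<theta> = 0) \<and>
     (\<forall>k\<in>{0..km}. \<forall>\<theta>\<in>weights. 0 < k \<and> (\<forall>i. 0 < \<theta> $ i) \<longrightarrow>
        (\<forall>y\<in>feasible_capital f km k - {0}. \<forall>xh. 0 < xh \<and> xh \<le> f k - y \<longrightarrow>
           (\<Sum>i\<in>UNIV. s xh \<theta> $ i) = xh \<and>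
           weighted_utility u \<theta> (s xh \<theta>) =
             (SUP x\<in>{x \<in> nonneg_profiles. (\<Sum>i\<in>UNIV. x $ i) \<le> xh}. weighted_utility u \<theta> x)))"

definition next_weights :: "('n::finite \<Rightarrow> real) \<Rightarrow> real ^ 'n \<Rightarrow> real ^ 'n" where
  "next_weights \<delta> \<theta> = (\<chi> i. \<theta> $ i * \<delta> i / (\<Sum>j\<in>UNIV. \<theta> $ j * \<delta> j))"

end

theory Submission
  imports Defs
begin

text \<open>
  Lifetime utility satisfies \<open>w(x) = u(x\<^sub>0) + \<delta> w(x\<^sub>1, x\<^sub>2, \<dots>)\<close>, and an
  allocation from \<open>k\<close> is a first-period profile, a next stock \<open>y \<in> \<Gamma>(k)\<close> and an allocation from
  \<open>y\<close>; so \<open>\<U>(k)\<close> consists of the vectors \<open>(u\<^sub>i(x\<^sup>i) + \<delta>\<^sup>i z\<^sup>i)\<^sub>i\<close> with \<open>z \<in> \<U>(y)\<close>. The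
  constraint of (PP) holds on \<open>\<U>(y)\<close> by the definition of \<open>V\<close>, whence the value of (PP) is \<open>V\<close>.
  For fixed \<open>y\<close> the supremum over \<open>x\<close> and \<open>z\<close> splits into \<open>U(f(k) - y, \<theta>)\<close> and
  \<open>sup \<Sum>\<^sub>i \<theta>\<^sup>i \<delta>\<^sup>i z\<^sup>i\<close>, and the latter is \<open>\<mu>(\<theta>) V(y, F(\<theta>))\<close> by homogeneity.
\<close>

section \<open>Arithmetic and suprema in the extended reals\<close>

lemma sum_ereal_neq_PInf:
  fixes g :: "'a \<Rightarrow> ereal"
  assumes "\<And>i. i \<in> A \<Longrightarrow> g i \<noteq> \<infinity>"
  shows "sum g A \<noteq> \<infinity>"
  using assms by (auto simp: sum_Pinfty)

lemma ereal_mult_neq_PInf: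
  assumes "0 \<le> c" "(a :: ereal) \<noteq> \<infinity>"
  shows "ereal c * a \<noteq> \<infinity>"
  using assms by (cases a) auto

lemma ereal_mult_sum:
  fixes g :: "'a \<Rightarrow> ereal"
  assumes "0 \<le> c"
  shows "ereal c * sum g A = (\<Sum>i\<in>A. ereal c * g i)"
  using sum_distrib_right_ereal[OF assms, of g A] by (simp add: mult.commute)

text \<open>At \<open>c = -\<infinity>\<close> an infinite but unattained supremum would give
  \<open>-\<infinity>\<close> on the left and \<open>\<infinity>\<close> on the right, since
  \<open>-\<infinity> + \<infinity> = \<infinity>\<close> in \<open>ereal\<close>; the assumption on
  the supremum excludes this.\<close>

lemma SUP_ereal_add_const:
  fixes g :: "'a \<Rightarrow> ereal"
  assumes "I \<noteq> {}" "(SUP i\<in>I. g i) \<noteq> \<infinity>"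
  shows "(SUP i\<in>I. c + g i) = c + (SUP i\<in>I. g i)"
proof (cases "c = -\<infinity>")
  case True
  have "g i \<noteq> \<infinity>" if "i \<in> I" for i
    using SUP_upper[OF that, of g] assms(2) by auto
  then have "(SUP i\<in>I. c + g i) = (SUP i\<in>I. -\<infinity>)"
    using True by (intro SUP_cong) auto
  then show ?thesis
    using True assms by simp
next
  case False
  then show ?thesis
    using assms(1) by (simp add: SUP_ereal_add_right)
qed

text \<open>Decouples current consumption from continuation utilities in the Bellman equation; each
  of the two suprema in turn serves as the varying summand, the other term being constant.\<close>

lemma SUP_ereal_add_split:
  fixes a :: "'a \<Rightarrow> ereal" and b :: "'b \<Rightarrow> ereal"
  assumes "A \<noteq> {}" "B \<noteq> {}" "(SUP x\<in>A. a x) \<noteq> \<infinity>" "(SUP z\<in>B. b z) \<noteq> \<infinity>"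
  shows "(SUP x\<in>A. SUP z\<in>B. a x + b z) = (SUP x\<in>A. a x) + (SUP z\<in>B. b z)"
  using assms by (simp add: SUP_ereal_add_const add.commute[of _ "Sup (b ` B)"])

section \<open>Discounted series of terms that are bounded above but possibly
  \<open>-\<infinity>\<close>\<close>

lemma summable_discounted:
  fixes a :: "nat \<Rightarrow> ereal"
  assumes d: "0 < d" "d < 1" and bd: "\<And>t. a t \<le> ereal M"
  shows "summable (\<lambda>t. ereal (d ^ t) * a t)"
    and "(\<Sum>t. ereal (d ^ t) * a t) \<le> ereal (M / (1 - d))"
proof -
  \<comment> \<open>Subtracting the bound makes all terms nonpositive, so that the partial sums are monotone.\<close>
  define S where "S n = (\<Sum>t<n. ereal (d ^ t) * (a t - ereal M))" for n
  define C where "C n = (\<Sum>t<n. d ^ t * M)" for n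
  have nonpos: "ereal (d ^ t) * (a t - ereal M) \<le> 0" for t
    using bd[of t] d by (cases "a t") (auto simp: mult_le_0_iff)
  have "decseq S"
    unfolding S_def
  proof (rule decseq_SucI)
    show "(\<Sum>t<Suc n. ereal (d ^ t) * (a t - ereal M)) \<le> (\<Sum>t<n. ereal (d ^ t) * (a t - ereal M))" for n
      using add_left_mono[OF nonpos[of n], of "\<Sum>t<n. ereal (d ^ t) * (a t - ereal M)"] by simp
  qed
  then have S: "S \<longlonglongrightarrow> (INF n. S n)"
    by (rule LIMSEQ_INF)
  have S0: "(INF n. S n) \<le> 0"
    by (rule INF_lower2[of 0]) (auto simp: S_def)
  have "(\<lambda>t. d ^ t * M) sums (1 / (1 - d) * M)"
    using d by (intro sums_mult2 geometric_sums) auto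
  then have "C \<longlonglongrightarrow> M / (1 - d)"
    by (simp add: sums_def C_def[abs_def])
  then have C: "(\<lambda>n. ereal (C n)) \<longlonglongrightarrow> ereal (M / (1 - d))"
    by simp
  \<comment> \<open>If \<open>a t = -\<infinity>\<close>, both sides are \<open>-\<infinity>\<close>
    because \<open>d ^ t > 0\<close>.\<close>
  have shift: "ereal (d ^ t) * a t = ereal (d ^ t * M) + ereal (d ^ t) * (a t - ereal M)" for t
    using bd[of t] d by (cases "a t") (auto simp: algebra_simps)
  have partial: "(\<Sum>t<n. ereal (d ^ t) * a t) = ereal (C n) + S n" for n
    unfolding S_def C_def sum_ereal[symmetric] sum.distrib[symmetric] by (intro sum.cong refl shift)
  \<comment> \<open>One of the two limits is finite, so their sum is not indeterminate even if the
    other is \<open>-\<infinity>\<close>.\<close>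
  have "(\<lambda>n. ereal (C n) + S n) \<longlonglongrightarrow> ereal (M / (1 - d)) + (INF n. S n)"
    by (rule tendsto_add_ereal_general[OF _ C S]) auto
  then have sums: "(\<lambda>t. ereal (d ^ t) * a t) sums (ereal (M / (1 - d)) + (INF n. S n))"
    by (simp add: sums_def partial)
  then show "summable (\<lambda>t. ereal (d ^ t) * a t)"
    by (rule sums_summable)
  show "(\<Sum>t. ereal (d ^ t) * a t) \<le> ereal (M / (1 - d))"
    using sums_unique[OF sums] add_left_mono[OF S0, of "ereal (M / (1 - d))"] by simp
qed

text \<open>The identity holds for partial sums and passes to the limit, because the upper bound
  keeps both summands of the limit away from \<open>\<infinity>\<close>.\<close>

lemma suminf_discounted_Suc:
  fixes a :: "nat \<Rightarrow> ereal"
  assumes d: "0 < d" "d < 1" and bd: "\<And>t. a t \<le> ereal M"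
  shows "(\<Sum>t. ereal (d ^ t) * a t) = a 0 + ereal d * (\<Sum>t. ereal (d ^ t) * a (Suc t))"
proof -
  let ?g = "\<lambda>t. ereal (d ^ t) * a (Suc t)"
  have "summable ?g" and le: "suminf ?g \<le> ereal (M / (1 - d))"
    using summable_discounted[of d "\<lambda>t. a (Suc t)"] assms by auto
  then have "(\<lambda>n. sum ?g {..<n}) \<longlonglongrightarrow> suminf ?g"
    by (simp add: summable_LIMSEQ)
  then have "(\<lambda>n. ereal d * sum ?g {..<n}) \<longlonglongrightarrow> ereal d * suminf ?g"
    by (intro tendsto_cmult_ereal) auto
  moreover have "a 0 \<noteq> \<infinity>" "ereal d * suminf ?g \<noteq> \<infinity>"
    using bd[of 0] le d by (auto intro!: ereal_mult_neq_PInf)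
  ultimately have lim: "(\<lambda>n. a 0 + ereal d * sum ?g {..<n}) \<longlonglongrightarrow> a 0 + ereal d * suminf ?g"
    by (intro tendsto_add_ereal_general) auto
  \<comment> \<open>The index runs to \<open>Suc n\<close> on the left only;
    \<open>LIMSEQ_imp_Suc\<close> removes the shift below.\<close>
  have "(\<Sum>t<Suc n. ereal (d ^ t) * a t) = a 0 + ereal d * sum ?g {..<n}" for n
    using d
    by (subst sum.lessThan_Suc_shift) (simp add: ereal_mult_sum mult.assoc[symmetric])
  then have "(\<lambda>n. \<Sum>t<Suc n. ereal (d ^ t) * a t) \<longlonglongrightarrow> a 0 + ereal d * suminf ?g"
    using lim by simp
  then have "(\<lambda>t. ereal (d ^ t) * a t) sums (a 0 + ereal d * suminf ?g)"
    unfolding sums_def by (rule LIMSEQ_imp_Suc)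
  then show ?thesis
    by (simp add: sums_iff)
qed

section \<open>Monotonicity and bounds for the primitives\<close>

context economy
begin

lemma discount_in_01: "0 < \<delta> i" "\<delta> i < 1"
proof -
  show "0 < \<delta> i"
    using discount_antimono[of i "Max UNIV"] discount_pos by simp
  show "\<delta> i < 1"
    using discount_antimono[of "Min UNIV" i] discount_lt_1 by simp
qed

lemma utility_neq_PInf: "0 \<le> x \<Longrightarrow> u i x \<noteq> \<infinity>"
  using utility[of i] by (simp add: admissible_utility_def)

lemma utility_mono: "0 \<le> x \<Longrightarrow> x \<le> y \<Longrightarrow> u i x \<le> u i y"
proof -
  assume "0 \<le> x" "x \<le> y"
  moreover have "strict_mono_on {0..} (u i)"
    using utility[of i] by (simp add: admissible_utility_def)
  ultimately show ?thesis
    using strict_mono_onD[of "{0..}" "u i" x y] by (cases "x = y") auto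
qed

lemma utility_bounded:
  assumes "0 \<le> B"
  obtains M where "\<And>x. 0 \<le> x \<Longrightarrow> x \<le> B \<Longrightarrow> u i x \<le> ereal M"
proof (rule that)
  \<comment> \<open>By monotonicity the value at \<open>B\<close> is a bound; if that value is
    \<open>-\<infinity>\<close>, \<open>real_of_ereal\<close> returns 0, which still bounds.\<close>
  show "u i x \<le> ereal (real_of_ereal (u i B))" if "0 \<le> x" "x \<le> B" for x
    using utility_mono[OF that, of i] utility_neq_PInf[OF assms, of i] by (cases "u i B") auto
qed

lemma technology_strict_mono: "0 \<le> x \<Longrightarrow> x < y \<Longrightarrow> f x < f y"
  using technology strict_mono_onD[of "{0..}" f x y] by (simp add: admissible_technology_def)

lemma technology_mono: "0 \<le> x \<Longrightarrow> x \<le> y \<Longrightarrow> f x \<le> f y"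
  using technology_strict_mono[of x y] by (cases "x = y") auto

lemma technology_nonneg: "0 \<le> x \<Longrightarrow> 0 \<le> f x"
  using technology by (simp add: admissible_technology_def)

lemma technology_le_km: "k \<in> {0..km} \<Longrightarrow> f k \<le> km"
  using technology_mono[of k km] km_fixed by simp

section \<open>Recursive structure of allocations and lifetime utility\<close>

lemma allocations_Suc:
  fixes x :: "nat \<Rightarrow> (real, 'n) vec"
  shows "x \<in> allocations f km k0 \<longleftrightarrow>
    x 0 \<in> nonneg_profiles \<and>
    (\<exists>y\<in>feasible_capital f km k0. (\<Sum>i\<in>UNIV. x 0 $ i) \<le> f k0 - y \<and>
       (\<lambda>t. x (Suc t)) \<in> allocations f km y)"
    (is "_ \<longleftrightarrow> ?R")
proof
  assume x: "x \<in> allocations f km k0"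
  then obtain k where k: "k \<in> capital_paths f km k0"
    and le: "\<And>t. 0 \<le> (\<Sum>i\<in>UNIV. x t $ i)" "\<And>t. (\<Sum>i\<in>UNIV. x t $ i) \<le> f (k t) - k (Suc t)"
    by (auto simp: allocations_def)
  have "(\<lambda>t. k (Suc t)) \<in> capital_paths f km (k 1)"
    using k by (auto simp: capital_paths_def)
  moreover have "bounded (range (\<lambda>t. x (Suc t)))"
    by (rule bounded_subset[of "range x"]) (use x in \<open>simp add: allocations_def\<close>, blast)
  moreover have "x (Suc t) \<in> nonneg_profiles" for t
    using x by (simp add: allocations_def)
  ultimately have "(\<lambda>t. x (Suc t)) \<in> allocations f km (k 1)"
    unfolding allocations_def mem_Collect_eq
    by (intro conjI allI bexI[of _ "\<lambda>t. k (Suc t)"] le)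
  moreover have "k 1 \<in> feasible_capital f km k0" "(\<Sum>i\<in>UNIV. x 0 $ i) \<le> f k0 - k 1"
    using k le(2)[of 0] by (auto simp: capital_paths_def)
  moreover have "x 0 \<in> nonneg_profiles"
    using x by (simp add: allocations_def)
  ultimately show ?R
    by blast
next
  assume ?R
  then obtain y where x0: "x 0 \<in> nonneg_profiles" and y: "y \<in> feasible_capital f km k0"
    and le0: "(\<Sum>i\<in>UNIV. x 0 $ i) \<le> f k0 - y" and xS: "(\<lambda>t. x (Suc t)) \<in> allocations f km y"
    by blast
  from xS obtain k where k: "k \<in> capital_paths f km y"
    and le: "\<And>t. (\<Sum>i\<in>UNIV. x (Suc t) $ i) \<le> f (k t) - k (Suc t)"
    by (auto simp: allocations_def)
  have nonneg: "x t \<in> nonneg_profiles" for t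
    using x0 xS by (cases t) (auto simp: allocations_def)
  have "range x = insert (x 0) (range (\<lambda>t. x (Suc t)))"
    by (subst UNIV_nat_eq) (simp add: image_image)
  then have "bounded (range x)"
    using xS by (simp add: allocations_def)
  \<comment> \<open>Putting \<open>k0\<close> in front of the path \<open>k\<close> is feasible at
    the joint because \<open>k 0 = y\<close>.\<close>
  moreover have "case_nat k0 k \<in> capital_paths f km k0"
    using k y by (auto simp: capital_paths_def split: nat.split)
  moreover have "(\<Sum>i\<in>UNIV. x t $ i) \<le> f (case_nat k0 k t) - case_nat k0 k (Suc t)" for t
    using le0 le k by (cases t) (auto simp: capital_paths_def)
  moreover have "0 \<le> (\<Sum>i\<in>UNIV. x t $ i)" for t
    using nonneg[of t] by (auto simp: nonneg_profiles_def intro: sum_nonneg)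
  ultimately show "x \<in> allocations f km k0"
    unfolding allocations_def mem_Collect_eq using nonneg
    by (intro conjI allI bexI[of _ "case_nat k0 k"])
qed

text \<open>Capital stays in \<open>[0, km]\<close>, where output is at most \<open>km\<close>, and
  no agent consumes more than total output. The bound is the same for all paths and dates, as the
  series estimates require.\<close>

lemma allocation_bounds:
  fixes x :: "nat \<Rightarrow> (real, 'n) vec"
  assumes x: "x \<in> allocations f km k0" and k0: "k0 \<in> {0..km}"
  shows "0 \<le> x t $ i" "x t $ i \<le> km"
proof -
  from x obtain k where k: "k \<in> capital_paths f km k0"
    and le: "(\<Sum>i\<in>UNIV. x t $ i) \<le> f (k t) - k (Suc t)"
    by (auto simp: allocations_def)
  have nonneg: "0 \<le> x t $ j" for j
    using x by (auto simp: allocations_def nonneg_profiles_def)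
  then show "0 \<le> x t $ i" .
  have "k t \<in> {0..km}"
    using k k0 by (cases t) (auto simp: capital_paths_def feasible_capital_def)
  moreover have "0 \<le> k (Suc t)"
    using k by (auto simp: capital_paths_def feasible_capital_def)
  moreover have "x t $ i \<le> (\<Sum>i\<in>UNIV. x t $ i)"
    using nonneg by (intro member_le_sum) auto
  ultimately show "x t $ i \<le> km"
    using le technology_le_km[of "k t"] by linarith
qed

lemma lifetime_utility_Suc:
  fixes x :: "nat \<Rightarrow> (real, 'n) vec"
  assumes x: "x \<in> allocations f km k" and k: "k \<in> {0..km}"
  shows "lifetime_utility (\<delta> i) (u i) (\<lambda>t. x t $ i) =
    u i (x 0 $ i) + ereal (\<delta> i) * lifetime_utility (\<delta> i) (u i) (\<lambda>t. x (Suc t) $ i)"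
proof -
  obtain M where "\<And>y. 0 \<le> y \<Longrightarrow> y \<le> km \<Longrightarrow> u i y \<le> ereal M"
    using utility_bounded km_pos by (metis less_imp_le)
  then show ?thesis
    unfolding lifetime_utility_def using allocation_bounds[OF x k] discount_in_01
    by (intro suminf_discounted_Suc[where M = M]) auto
qed

section \<open>The utility possibility sets\<close>

lemma zero_feasible_capital: "0 \<le> k \<Longrightarrow> 0 \<in> feasible_capital f km k"
  using km_pos technology_nonneg by (simp add: feasible_capital_def)

text \<open>Giving up all capital at once and consuming nothing is always possible; this makes the
  utility possibility sets nonempty.\<close>

lemma zero_allocation:
  assumes "0 \<le> k"
  shows "(\<lambda>_. 0 :: (real, 'n) vec) \<in> allocations f km k"
proof -
  let ?k = "\<lambda>t. if t = (0::nat) then k else 0"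
  have "?k \<in> capital_paths f km k"
    using assms zero_feasible_capital by (auto simp: capital_paths_def)
  then show ?thesis
    unfolding allocations_def mem_Collect_eq using assms technology_nonneg[of k] technology_nonneg[of 0]
    by (intro conjI bexI[of _ ?k]) (auto simp: nonneg_profiles_def)
qed

lemma utility_possibilitiesI:
  fixes x :: "nat \<Rightarrow> (real, 'n) vec"
  assumes "x \<in> allocations f km k"
  shows "(\<chi> i. lifetime_utility (\<delta> i) (u i) (\<lambda>t. x t $ i)) \<in> utility_possibilities \<delta> u f km k"
  unfolding utility_possibilities_def mem_Collect_eq using assms by (intro bexI[of _ x]) simp_all

lemma utility_possibilities_nonempty: "0 \<le> k \<Longrightarrow> utility_possibilities \<delta> u f km k \<noteq> {}"
  using utility_possibilitiesI[OF zero_allocation] by blast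

lemma utility_possibilities_bounded:
  obtains M where "\<And>k z. k \<in> {0..km} \<Longrightarrow> z \<in> utility_possibilities \<delta> u f km k \<Longrightarrow> z $ i \<le> ereal M"
proof -
  obtain M where M: "\<And>y. 0 \<le> y \<Longrightarrow> y \<le> km \<Longrightarrow> u i y \<le> ereal M"
    using utility_bounded km_pos by (metis less_imp_le)
  show ?thesis
  proof (rule that)
    fix k z
    assume k: "k \<in> {0..km}" and "z \<in> utility_possibilities \<delta> u f km k"
    then obtain x where x: "x \<in> allocations f km k"
      and z: "z $ i = lifetime_utility (\<delta> i) (u i) (\<lambda>t. x t $ i)"
      by (auto simp: utility_possibilities_def)
    \<comment> \<open>The one-period bound \<open>M\<close>, summed as a geometric series, is
      independent of the initial stock.\<close>
    show "z $ i \<le> ereal (M / (1 - \<delta> i))"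
      unfolding z lifetime_utility_def
      using discount_in_01 allocation_bounds[OF x k] M by (intro summable_discounted(2)) auto
  qed
qed

text \<open>Principle of optimality for utility vectors: the tail of an allocation realises the
  continuation vector, and any profile affordable today can be put in front of an allocation from
  \<open>y\<close>.\<close>

lemma utility_possibilities_Suc:
  assumes k: "k \<in> {0..km}"
  shows "utility_possibilities \<delta> u f km k =
    {\<chi> i. u i (x $ i) + ereal (\<delta> i) * z $ i | x y z.
       x \<in> nonneg_profiles \<and> y \<in> feasible_capital f km k \<and>
       (\<Sum>i\<in>UNIV. x $ i) \<le> f k - y \<and> z \<in> utility_possibilities \<delta> u f km y}"
    (is "_ = ?R")
proof
  show "utility_possibilities \<delta> u f km k \<subseteq> ?R"
  proof
    fix v
    assume "v \<in> utility_possibilities \<delta> u f km k"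
    then obtain x where x: "x \<in> allocations f km k"
      and v: "\<And>i. v $ i = lifetime_utility (\<delta> i) (u i) (\<lambda>t. x t $ i)"
      by (auto simp: utility_possibilities_def)
    from x obtain y where y: "y \<in> feasible_capital f km k" "x 0 \<in> nonneg_profiles"
      "(\<Sum>i\<in>UNIV. x 0 $ i) \<le> f k - y" "(\<lambda>t. x (Suc t)) \<in> allocations f km y"
      using allocations_Suc by blast
    define z where "z = (\<chi> i. lifetime_utility (\<delta> i) (u i) (\<lambda>t. x (Suc t) $ i))"
    have "z \<in> utility_possibilities \<delta> u f km y"
      unfolding z_def by (rule utility_possibilitiesI[OF y(4)])
    moreover have "v = (\<chi> i. u i (x 0 $ i) + ereal (\<delta> i) * z $ i)"
      by (simp add: vec_eq_iff v z_def lifetime_utility_Suc[OF x k])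
    ultimately show "v \<in> ?R"
      using y by blast
  qed
next
  show "?R \<subseteq> utility_possibilities \<delta> u f km k"
  proof
    fix v
    assume "v \<in> ?R"
    then obtain x0 y z where v: "v = (\<chi> i. u i (x0 $ i) + ereal (\<delta> i) * z $ i)"
      and y: "x0 \<in> nonneg_profiles" "y \<in> feasible_capital f km k"
        "(\<Sum>i\<in>UNIV. x0 $ i) \<le> f k - y" "z \<in> utility_possibilities \<delta> u f km y"
      by blast
    from y(4) obtain x' where x': "x' \<in> allocations f km y"
      and z: "\<And>i. z $ i = lifetime_utility (\<delta> i) (u i) (\<lambda>t. x' t $ i)"
      by (auto simp: utility_possibilities_def)
    define x where "x = case_nat x0 x'"
    have x: "x \<in> allocations f km k"
      using x' y by (subst allocations_Suc) (auto simp: x_def)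
    moreover have "v $ i = lifetime_utility (\<delta> i) (u i) (\<lambda>t. x t $ i)" for i
      unfolding lifetime_utility_Suc[OF x k] by (simp add: v z x_def)
    ultimately show "v \<in> utility_possibilities \<delta> u f km k"
      by (auto simp: utility_possibilities_def)
  qed
qed

section \<open>Problem (PP) and the transition of the weights\<close>

lemma pp_feasible_iff:
  assumes "k \<in> {0..km}"
  shows "(x, y, z) \<in> pp_feasible \<delta> u f km k \<longleftrightarrow>
    x \<in> nonneg_profiles \<and> y \<in> feasible_capital f km k \<and>
    (\<Sum>i\<in>UNIV. x $ i) \<le> f k - y \<and> z \<in> utility_possibilities \<delta> u f km y"
proof -
  have "0 \<le> (\<Sum>i\<in>UNIV. x $ i)" if "x \<in> nonneg_profiles"
    using that by (auto simp: nonneg_profiles_def intro: sum_nonneg)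
  \<comment> \<open>The constraint over all weights is automatic on the utility possibility set,
    \<open>pareto_value\<close> being the supremum of these very sums.\<close>
  moreover have "(\<Sum>i\<in>UNIV. ereal (\<tau> $ i) * z $ i) \<le> pareto_value \<delta> u f km y \<tau>"
    if "z \<in> utility_possibilities \<delta> u f km y" for \<tau>
    unfolding pareto_value_def using that by (rule SUP_upper)
  \<comment> \<open>The bound \<open>y \<le> km\<close>, absent from (PP), follows from
    \<open>y \<le> f k \<le> km\<close>.\<close>
  ultimately show ?thesis
    using technology_le_km[OF assms] by (force simp: pp_feasible_def feasible_capital_def)
qed

text \<open>The objective of (PP) is constant in \<tau>, so its infimum is that constant; over an
  empty set the infimum would be \<open>\<infinity>\<close>.\<close>

lemma weights_nonempty: "(weights :: ((real, 'n) vec) set) \<noteq> {}"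
proof -
  have "(\<chi> i. 1 / real CARD('n)) \<in> (weights :: ((real, 'n) vec) set)"
    by (simp add: weights_def nonneg_profiles_def)
  then show ?thesis
    by blast
qed

lemma pp_value_eq_pareto_value:
  assumes k: "k \<in> {0..km}"
  shows "pp_value \<delta> u f km k \<theta> = pareto_value \<delta> u f km k \<theta>"
proof -
  let ?g = "\<lambda>x z. \<chi> i. u i (x $ i) + ereal (\<delta> i) * z $ i"
  have U: "utility_possibilities \<delta> u f km k = (\<lambda>(x, y, z). ?g x z) ` pp_feasible \<delta> u f km k"
    unfolding utility_possibilities_Suc[OF k] pp_feasible_iff[OF k, symmetric]
    by (force simp: image_iff)
  show ?thesis
    unfolding pp_value_def pareto_value_def U image_image
    using weights_nonempty by (intro SUP_cong) auto
qed

text \<open>Multiplication by the positive total cancels the normalisation in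
  \<open>next_weights\<close>, and a positive real factor moves through sums and suprema in
  \<open>ereal\<close>.\<close>

lemma next_weights_value:
  assumes \<theta>: "\<theta> \<in> weights" "\<And>i. 0 < \<theta> $ i"
  shows "ereal (\<Sum>i\<in>UNIV. \<theta> $ i * \<delta> i) * pareto_value \<delta> u f km y (next_weights \<delta> \<theta>) =
    (SUP z\<in>utility_possibilities \<delta> u f km y. \<Sum>i\<in>UNIV. ereal (\<theta> $ i * \<delta> i) * z $ i)"
    (is "ereal ?\<mu> * _ = _")
proof -
  have pos: "0 < ?\<mu>"
    using \<theta>(2) discount_in_01 by (intro sum_pos) auto
  have scale: "ereal ?\<mu> * (\<Sum>i\<in>UNIV. ereal (next_weights \<delta> \<theta> $ i) * z $ i) =
      (\<Sum>i\<in>UNIV. ereal (\<theta> $ i * \<delta> i) * z $ i)" for z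
  proof -
    have "ereal ?\<mu> * (\<Sum>i\<in>UNIV. ereal (next_weights \<delta> \<theta> $ i) * z $ i) =
        (\<Sum>i\<in>UNIV. ereal ?\<mu> * (ereal (next_weights \<delta> \<theta> $ i) * z $ i))"
      using pos by (intro ereal_mult_sum) simp
    also have "\<dots> = (\<Sum>i\<in>UNIV. ereal (\<theta> $ i * \<delta> i) * z $ i)"
      using pos by (intro sum.cong refl) (simp add: next_weights_def mult.assoc[symmetric])
    finally show ?thesis .
  qed
  show ?thesis
    unfolding pareto_value_def scale[symmetric]
    \<comment> \<open>As \<open>y\<close> is arbitrary, the set may be empty; both sides are then
      \<open>-\<infinity>\<close>, the factor being positive.\<close>
    using pos by (cases "utility_possibilities \<delta> u f km y = {}") (auto simp: Sup_ereal_mult_left' bot_ereal_def)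
qed


section \<open>The aggregate utility and the Bellman equation\<close>

lemma weighted_utility_neq_PInf:
  assumes "\<theta> \<in> weights" "x \<in> nonneg_profiles"
  shows "weighted_utility u \<theta> x \<noteq> \<infinity>"
  unfolding weighted_utility_def using assms utility_neq_PInf
  by (intro sum_ereal_neq_PInf ereal_mult_neq_PInf) (auto simp: weights_def nonneg_profiles_def)

lemma optimal_profile_aggregate:
  assumes s: "optimal_profile u f km s" and \<theta>: "\<theta> \<in> weights" "\<And>i. 0 < \<theta> $ i"
    and xh: "0 \<le> xh" "xh < km"
  shows "weighted_utility u \<theta> (s xh \<theta>) =
    (SUP x\<in>{x \<in> nonneg_profiles. (\<Sum>i\<in>UNIV. x $ i) \<le> xh}. weighted_utility u \<theta> x)"
proof (cases "xh = 0")
  case True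
  \<comment> \<open>At level 0 the zero profile is the only candidate, so the convention
    \<open>s 0 \<theta> = 0\<close> gives optimality there.\<close>
  have "x = 0" if "x \<in> nonneg_profiles" "(\<Sum>i\<in>UNIV. x $ i) \<le> 0" for x :: "(real, 'n) vec"
  proof -
    have "(\<Sum>i\<in>UNIV. x $ i) = 0"
      using that by (intro antisym sum_nonneg) (auto simp: nonneg_profiles_def)
    then show ?thesis
      using that(1) by (simp add: nonneg_profiles_def vec_eq_iff sum_nonneg_eq_0_iff)
  qed
  then have "{x \<in> nonneg_profiles. (\<Sum>i\<in>UNIV. x $ i) \<le> xh} = {0 :: (real, 'n) vec}"
    using True by (auto simp: nonneg_profiles_def)
  moreover have "s xh \<theta> = 0"
    using s \<theta>(1) True by (simp add: optimal_profile_def)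
  ultimately show ?thesis
    by simp
next
  case False
  \<comment> \<open>Every level below \<open>km\<close> leaves a positive stock when starting from \<open>km\<close>.\<close>
  have "km \<in> {0..km}" "0 < km" "km - xh \<in> feasible_capital f km km - {0}" "xh \<le> f km - (km - xh)"
    using km_pos km_fixed xh by (auto simp: feasible_capital_def)
  moreover have "0 < xh"
    using False xh by simp
  ultimately show ?thesis
    using s \<theta> unfolding optimal_profile_def by blast
qed

lemma pareto_value_Bellman:
  assumes s: "optimal_profile u f km s" and k: "0 < k" "k < km"
    and \<theta>: "\<theta> \<in> weights" "\<And>i. 0 < \<theta> $ i"
  shows "pareto_value \<delta> u f km k \<theta> =
    (SUP y\<in>feasible_capital f km k. weighted_utility u \<theta> (s (f k - y) \<theta>) +
       ereal (\<Sum>i\<in>UNIV. \<theta> $ i * \<delta> i) * pareto_value \<delta> u f km y (next_weights \<delta> \<theta>))"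
proof -
  let ?A = "\<lambda>y. {x \<in> nonneg_profiles. (\<Sum>i\<in>UNIV. x $ i) \<le> f k - y} :: ((real, 'n) vec) set"
  let ?Z = "utility_possibilities \<delta> u f km"
  let ?c = "\<lambda>z. \<Sum>i\<in>UNIV. ereal (\<theta> $ i * \<delta> i) * z $ i"
  let ?v = "\<lambda>x z. \<chi> i. u i (x $ i) + ereal (\<delta> i) * z $ i"
  have k': "k \<in> {0..km}"
    using k by simp
  have value_v: "(\<Sum>i\<in>UNIV. ereal (\<theta> $ i) * ?v x z $ i) = weighted_utility u \<theta> x + ?c z" for x z
    using \<theta>(2)
    by (simp add: weighted_utility_def sum.distrib[symmetric] ereal_pos_distrib less_imp_le
        mult.assoc[symmetric])
  \<comment> \<open>Taking the union over \<open>y\<close> outermost makes the value an iterated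
    supremum in which \<open>x\<close> and \<open>z\<close> range independently once
    \<open>y\<close> is fixed.\<close>
  have "?Z k = (\<Union>y\<in>feasible_capital f km k. \<Union>x\<in>?A y. ?v x ` ?Z y)"
    unfolding utility_possibilities_Suc[OF k'] by blast
  then have "pareto_value \<delta> u f km k \<theta> =
      (SUP y\<in>feasible_capital f km k. SUP x\<in>?A y. SUP z\<in>?Z y. weighted_utility u \<theta> x + ?c z)"
    unfolding pareto_value_def by (simp only: SUP_UNION image_image value_v)
  also have "\<dots> = (SUP y\<in>feasible_capital f km k. weighted_utility u \<theta> (s (f k - y) \<theta>) +
       ereal (\<Sum>i\<in>UNIV. \<theta> $ i * \<delta> i) * pareto_value \<delta> u f km y (next_weights \<delta> \<theta>))"
  proof (intro SUP_cong refl)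
    fix y
    assume "y \<in> feasible_capital f km k"
    then have y: "y \<in> {0..km}" "y \<le> f k"
      by (auto simp: feasible_capital_def)
    \<comment> \<open>Strictness comes from \<open>k < km\<close>, as
      \<open>f k < f km = km\<close>; it places even the level \<open>f k\<close>, at
      \<open>y = 0\<close>, where \<open>s\<close> is known to be optimal.\<close>
    have xh: "0 \<le> f k - y" "f k - y < km"
      using y technology_strict_mono[of k km] k km_fixed by auto
    have opt: "(SUP x\<in>?A y. weighted_utility u \<theta> x) = weighted_utility u \<theta> (s (f k - y) \<theta>)"
      using optimal_profile_aggregate[OF s \<theta> xh] by simp
    have "s (f k - y) \<theta> \<in> nonneg_profiles"
      using s \<theta>(1) k' xh \<open>y \<in> feasible_capital f km k\<close>
      unfolding optimal_profile_def aggregate_levels_def by blast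
    then have "(SUP x\<in>?A y. weighted_utility u \<theta> x) \<noteq> \<infinity>"
      unfolding opt by (rule weighted_utility_neq_PInf[OF \<theta>(1)])
    moreover have "(SUP z\<in>?Z y. ?c z) \<noteq> \<infinity>"
    proof -
      \<comment> \<open>Each agent has a separate bound; their weighted sum is a finite bound for
        the supremum.\<close>
      have "\<exists>M. \<forall>z\<in>?Z y. z $ i \<le> ereal M" for i
        using utility_possibilities_bounded[of i] y(1) by metis
      then obtain M where M: "\<And>z i. z \<in> ?Z y \<Longrightarrow> z $ i \<le> ereal (M i)"
        by metis
      have "(SUP z\<in>?Z y. ?c z) \<le> (\<Sum>i\<in>UNIV. ereal (\<theta> $ i * \<delta> i) * ereal (M i))"
        using M \<theta>(2) discount_in_01
        by (intro SUP_least sum_mono ereal_mult_left_mono) (auto simp: less_imp_le)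
      then show ?thesis
        by auto
    qed
    moreover have "?A y \<noteq> {}"
      using xh(1) by (auto simp: nonneg_profiles_def intro!: exI[of _ 0])
    moreover have "?Z y \<noteq> {}"
      using y(1) utility_possibilities_nonempty by auto
    ultimately have "(SUP x\<in>?A y. SUP z\<in>?Z y. weighted_utility u \<theta> x + ?c z) =
        (SUP x\<in>?A y. weighted_utility u \<theta> x) + (SUP z\<in>?Z y. ?c z)"
      by (intro SUP_ereal_add_split)
    then show "(SUP x\<in>?A y. SUP z\<in>?Z y. weighted_utility u \<theta> x + ?c z) =
        weighted_utility u \<theta> (s (f k - y) \<theta>) +
        ereal (\<Sum>i\<in>UNIV. \<theta> $ i * \<delta> i) * pareto_value \<delta> u f km y (next_weights \<delta> \<theta>)"
      by (simp only: opt next_weights_value[OF \<theta>])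
  qed
  finally show ?thesis .
qed

end

theorem theorem2p6:
  fixes \<delta> :: "'n::{finite,linorder} \<Rightarrow> real"
    and u :: "'n \<Rightarrow> real \<Rightarrow> ereal"
    and f :: "real \<Rightarrow> real"
    and km :: real
    and s :: "real \<Rightarrow> (real, 'n) vec \<Rightarrow> (real, 'n) vec"
  assumes "economy \<delta> u f km"
    and "optimal_profile u f km s"
  shows "\<exists>(U :: real \<Rightarrow> (real, 'n) vec \<Rightarrow> ereal) (\<mu> :: (real, 'n) vec \<Rightarrow> real).
    (\<forall>xh\<in>aggregate_levels f km. \<forall>\<theta>\<in>weights.
       U xh \<theta> = (\<Sum>i\<in>UNIV. ereal (\<theta> $ i) * u i (s xh \<theta> $ i)) \<and> U xh \<theta> \<noteq> \<infinity>) \<and>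
    (\<forall>\<theta>\<in>weights. \<mu> \<theta> = (\<Sum>i\<in>UNIV. \<theta> $ i * \<delta> i) \<and> 0 \<le> \<mu> \<theta>) \<and>
    (\<forall>k\<in>{0..km}. \<forall>\<theta>\<in>weights. pp_value \<delta> u f km k \<theta> = pareto_value \<delta> u f km k \<theta>) \<and>
    (\<forall>k \<theta>. 0 < k \<and> k < km \<and> \<theta> \<in> weights \<and> (\<forall>i. 0 < \<theta> $ i) \<longrightarrow>
       pareto_value \<delta> u f km k \<theta> =
         (SUP y\<in>feasible_capital f km k.
            U (f k - y) \<theta> + ereal (\<mu> \<theta>) * pareto_value \<delta> u f km y (next_weights \<delta> \<theta>)))"
proof -
  interpret economy \<delta> u f km
    by (rule assms(1))
  let ?\<mu> = "\<lambda>\<theta> :: (real, 'n) vec. \<Sum>i\<in>UNIV. \<theta> $ i * \<delta> i"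
  \<comment> \<open>Since \<open>ereal\<close> contains \<open>\<infinity>\<close>, it must be shown
    that \<open>U\<close> takes values in the reals and \<open>-\<infinity>\<close> only.\<close>
  have "weighted_utility u \<theta> (s xh \<theta>) \<noteq> \<infinity>" if "xh \<in> aggregate_levels f km" "\<theta> \<in> weights" for xh \<theta>
    using that assms(2) by (intro weighted_utility_neq_PInf) (auto simp: optimal_profile_def)
  moreover have "0 \<le> ?\<mu> \<theta>" if "\<theta> \<in> weights" for \<theta>
    using that discount_in_01
    by (auto simp: weights_def nonneg_profiles_def less_imp_le intro!: sum_nonneg)
  ultimately show ?thesis
    using pp_value_eq_pareto_value pareto_value_Bellman[OF assms(2)]
    by (intro exI[of _ "\<lambda>xh \<theta>. weighted_utility u \<theta> (s xh \<theta>)"] exI[of _ ?\<mu>])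
      (simp add: weighted_utility_def)
qed

end
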